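(* Let $R$ be a finite nonzero commutative ring of cardinality $q$, and let $T:R[[x]]\to R[[x]]$ be the Collatz map defined below. \begin{enumerate} \item The eventually $T$-periodic power series in $R[[x]]$ are precisely the series of the form $u(1+xv)^{-1}$ with $u,v\in R[x]$. \item Let $n\ge 1$. Then the number $Z_n$ of $T$-cycles of length $n$ in $R[[x]]$ is finite. Moreover, with $b=4q-3$, $\alpha=\frac{1+\sqrt b}{2}$, $\beta=\frac{1-\sqrt b}{2}$, $$Z_n=\frac1n\sum_{d\mid n}\mu(d)\left(\alpha^{n/d}+\beta^{n/d}\right),$$ and $Z_n\sim \frac{\alpha^n}{n}$ as $n\to\infty$. \end{enumerate}
   Context: For $f\in R[[x]]$ let $f_0$ be its constant coefficient. The Collatz map on $R[[x]]$ is $T(f)=(x+1)f-f_0$ if $f_0\neq 0$ and $T(f)=f/x$ if $f_0=0$. A series $f$ is $T$-periodic if $T^k(f)=f$ for some $k\ge 1$; the minimal such $k$ is its period, and its orbit $\{f,T(f),\dots\}$ is a $T$-cycle whose length is that period. A series is eventually $T$-periodic if some iterate $T^m(f)$, $m\ge0$, is $T$-periodic. $\mu$ is the Möbius function. *)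

theory Defs
  imports
    Complex_Main
    "HOL-Computational_Algebra.Computational_Algebra"
    "HOL-Library.Cardinality"
    "HOL-Library.Landau_Symbols"
begin

text \<open>The quotient of \<open>f\<close> by the indeterminate is written with \<^const>\<open>fps_shift\<close>, because division of
  formal power series is only available over rings with an inverse operation.\<close>

definition collatz :: "'a::comm_ring_1 fps \<Rightarrow> 'a fps" where
  "collatz f = (if fps_nth f 0 \<noteq> 0 then (fps_X + 1) * f - fps_const (fps_nth f 0) else fps_shift 1 f)"

lemma fps_X_mult_collatz:
  assumes "fps_nth f 0 = 0"
  shows "fps_X * collatz f = f"
  by (rule fps_ext) (use assms in \<open>auto simp: collatz_def\<close>)

definition map_periodic :: "('b \<Rightarrow> 'b) \<Rightarrow> 'b \<Rightarrow> bool" where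
  "map_periodic T f \<longleftrightarrow> (\<exists>k\<ge>1. (T ^^ k) f = f)"

definition eventually_map_periodic :: "('b \<Rightarrow> 'b) \<Rightarrow> 'b \<Rightarrow> bool" where
  "eventually_map_periodic T f \<longleftrightarrow> (\<exists>m. map_periodic T ((T ^^ m) f))"

text \<open>Only meaningful for periodic points.\<close>

definition map_period :: "('b \<Rightarrow> 'b) \<Rightarrow> 'b \<Rightarrow> nat" where
  "map_period T f = (LEAST k. k \<ge> 1 \<and> (T ^^ k) f = f)"

definition map_orbit :: "('b \<Rightarrow> 'b) \<Rightarrow> 'b \<Rightarrow> 'b set" where
  "map_orbit T f = range (\<lambda>k. (T ^^ k) f)"

definition map_cycles :: "('b \<Rightarrow> 'b) \<Rightarrow> nat \<Rightarrow> 'b set set" where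
  "map_cycles T n = {map_orbit T f | f. map_periodic T f \<and> map_period T f = n}"

definition moebius :: "nat \<Rightarrow> int" where
  "moebius n = (if squarefree n then (-1) ^ card (prime_factors n) else 0)"

text \<open>Over a commutative ring, \<open>fps_right_inverse f y\<close> is the inverse of \<open>f\<close> whenever \<open>y\<close> is an
  inverse of the constant coefficient of \<open>f\<close>; the class-based \<^const>\<open>inverse\<close> is not available
  at this generality.\<close>

definition one_plus_X_mult_inverse :: "'a::comm_ring_1 poly \<Rightarrow> 'a fps" where
  "one_plus_X_mult_inverse v = fps_right_inverse (1 + fps_X * fps_of_poly v) 1"

lemma one_plus_X_mult_inverse:
  "(1 + fps_X * fps_of_poly v) * one_plus_X_mult_inverse v = 1"
  unfolding one_plus_X_mult_inverse_def by (rule fps_right_inverse) simp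

end

theory Submission
  imports Defs
begin

text \<open>Recording the constant coefficients of the iterates of \<open>f\<close> conjugates the Collatz map to the
  shift on the sequences over \<open>R\<close> in which every nonzero term is followed by zero: each step of
  the Collatz map can be undone once the constant coefficient is known, and undoing it determines one
  more coefficient of \<open>f\<close>. The points fixed by the \<open>n\<close>-th iterate thus correspond to closed walks of
  length \<open>n\<close>, whose number satisfies \<open>t (n + 2) = t (n + 1) + (q - 1) * t n\<close>, so it equals
  \<open>\<alpha> ^ n + \<beta> ^ n\<close>; Moebius inversion then counts the cycles, and the term \<open>d = 1\<close> dominates.

  For the first part, iterating along a periodic orbit gives an affine relation between \<open>f\<close> and
  itself with polynomial coefficients, which makes \<open>f\<close> rational. Conversely, the Collatz map keeps
  the denominator \<open>1 + x v\<close> and bounds the degree of the numerator, so over a finite ring the orbit is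
  finite.\<close>

section \<open>Moebius inversion\<close>

lemma moebius_prime_mult:
  assumes p: "prime (p::nat)" and d: "squarefree d" and pd: "\<not> p dvd d"
  shows "moebius (p * d) = - moebius d"
proof -
  have d0: "d \<noteq> 0" using d by (metis not_squarefree_0)
  have sq: "squarefree (p * d)"
    using p d pd by (intro squarefree_mult_coprime) (auto simp: squarefree_prime prime_imp_coprime)
  have pf: "prime_factors (p * d) = insert p (prime_factors d)"
    using p d0 by (simp add: prime_factorization_mult prime_factorization_prime prime_gt_0_nat)
  have "p \<notin> prime_factors d" using pd by auto
  with sq d pf show ?thesis by (simp add: moebius_def)
qed

text \<open>For a prime \<open>p\<close> dividing \<open>n\<close>, multiplication by
  \<open>p\<close> pairs the squarefree divisors prime to \<open>p\<close> with those divisible by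
  \<open>p\<close>, and paired terms have opposite signs.\<close>

lemma sum_moebius_divisors:
  assumes n: "n \<ge> 1"
  shows "(\<Sum>d | d dvd n. moebius d) = (if n = 1 then 1 else 0)"
proof (cases "n = 1")
  case True
  then show ?thesis by (simp add: moebius_def)
next
  case False
  then obtain p where p: "prime p" "p dvd n" by (meson prime_factor_nat)
  \<comment> \<open>The squarefree divisors of \<open>n\<close> are the disjoint union of
    \<open>A\<close> and \<open>p\<close> times \<open>A\<close>.\<close>
  define A where "A = {d. d dvd n \<and> squarefree d \<and> \<not> p dvd d}"
  have fin: "finite {d. d dvd n}" using n by simp
  have finA: "finite A" by (rule finite_subset[OF _ fin]) (auto simp: A_def)
  have split: "{d. d dvd n \<and> squarefree d} = A \<union> (*) p ` A"
  proof (intro equalityI subsetI)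
    fix d assume d: "d \<in> {d. d dvd n \<and> squarefree d}"
    show "d \<in> A \<union> (*) p ` A"
    proof (cases "p dvd d")
      case True
      then obtain e where e: "d = p * e" by auto
      have "\<not> p dvd e"
      proof
        assume "p dvd e"
        hence "p ^ 2 dvd d" by (simp add: e power2_eq_square mult_dvd_mono)
        with d have "is_unit p" by (auto dest: squarefreeD)
        with p show False by (auto simp: prime_nat_iff)
      qed
      moreover have "e dvd n" using d e by auto
      moreover have "squarefree e" using d e by (auto intro: squarefree_mono[of e d])
      ultimately show ?thesis using e by (auto simp: A_def)
    qed (use d in \<open>auto simp: A_def\<close>)
  next
    fix d assume "d \<in> A \<union> (*) p ` A"
    then show "d \<in> {d. d dvd n \<and> squarefree d}"
    proof
      assume "d \<in> (*) p ` A"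
      then obtain e where e: "d = p * e" "e dvd n" "squarefree e" "\<not> p dvd e" by (auto simp: A_def)
      then have "coprime p e" using p by (simp add: prime_imp_coprime)
      then show ?thesis using e p squarefree_prime[OF p(1)] by (auto intro!: divides_mult squarefree_mult_coprime)
    qed (auto simp: A_def)
  qed
  have "(\<Sum>d | d dvd n. moebius d) = sum moebius {d. d dvd n \<and> squarefree d}"
    using fin by (intro sum.mono_neutral_right) (auto simp: moebius_def)
  also have "\<dots> = sum moebius A + sum moebius ((*) p ` A)"
    unfolding split using finA by (intro sum.union_disjoint) (auto simp: A_def)
  also have "sum moebius ((*) p ` A) = (\<Sum>d\<in>A. moebius (p * d))"
    using p by (subst sum.reindex) (auto simp: inj_on_def)
  also have "\<dots> = (\<Sum>d\<in>A. - moebius d)"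
    using p by (intro sum.cong) (auto simp: A_def moebius_prime_mult)
  finally show ?thesis using False by (simp add: sum_negf)
qed

text \<open>Inserting the formula for \<open>f\<close> and exchanging the sums puts a full divisor
  sum of \<open>moebius\<close> over \<open>n div e\<close> in front of \<open>g e\<close>; it
  vanishes unless \<open>e = n\<close>.\<close>

lemma moebius_inversion:
  fixes f g :: "nat \<Rightarrow> real"
  assumes n: "n \<ge> 1" and f: "\<And>m. m \<ge> 1 \<Longrightarrow> f m = (\<Sum>d | d dvd m. g d)"
  shows "g n = (\<Sum>d | d dvd n. real_of_int (moebius d) * f (n div d))"
proof -
  have pos: "n div d \<ge> 1" "d \<ge> 1" if "d dvd n" for d
    using that n by (auto elim!: dvdE simp: Suc_le_eq)
  have fin: "finite {d. d dvd n}" "d dvd n \<Longrightarrow> finite {e. e dvd n div d}" for d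
    using n pos(1)[of d] by simp_all
  \<comment> \<open>Both sides say that \<open>d * e\<close> divides \<open>n\<close>.\<close>
  have swap: "d dvd n \<and> e dvd n div d \<longleftrightarrow> e dvd n \<and> d dvd n div e" for d e
    using n by (metis dvd_div_iff_mult dvd_mult_left dvd_0_left_iff mult.commute not_one_le_zero)
  have "(\<Sum>d | d dvd n. real_of_int (moebius d) * f (n div d))
      = (\<Sum>d | d dvd n. \<Sum>e | e dvd n div d. real_of_int (moebius d) * g e)"
    using pos by (intro sum.cong) (auto simp: f sum_distrib_left)
  also have "\<dots> = (\<Sum>(d, e) \<in> Sigma {d. d dvd n} (\<lambda>d. {e. e dvd n div d}). real_of_int (moebius d) * g e)"
    using fin by (subst sum.Sigma) auto
  also have "\<dots> = (\<Sum>(e, d) \<in> Sigma {d. d dvd n} (\<lambda>d. {e. e dvd n div d}). real_of_int (moebius d) * g e)"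
    by (rule sum.reindex_bij_witness[of _ "\<lambda>(d,e). (e,d)" "\<lambda>(d,e). (e,d)"]) (use swap in auto)
  also have "\<dots> = (\<Sum>e | e dvd n. \<Sum>d | d dvd n div e. real_of_int (moebius d) * g e)"
    using fin by (subst sum.Sigma) auto
  also have "\<dots> = (\<Sum>e | e dvd n. real_of_int (\<Sum>d | d dvd n div e. moebius d) * g e)"
    by (simp add: sum_distrib_right)
  also have "\<dots> = (\<Sum>e | e dvd n. if e = n then g e else 0)"
  proof (intro sum.cong refl)
    fix e assume "e \<in> {e. e dvd n}"
    hence e: "e dvd n" by simp
    then have "n div e = 1 \<longleftrightarrow> e = n" using n by (metis dvd_div_mult_self div_self mult_1 not_one_le_zero)
    with sum_moebius_divisors[OF pos(1)[OF e]]
    show "real_of_int (\<Sum>d | d dvd n div e. moebius d) * g e = (if e = n then g e else 0)" by simp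
  qed
  also have "\<dots> = g n" using fin by simp
  finally show ?thesis by simp
qed

section \<open>Cycles of a self-map\<close>

lemma map_period:
  assumes "map_periodic T f"
  shows "map_period T f \<ge> 1" "(T ^^ map_period T f) f = f"
  using LeastI_ex[of "\<lambda>k. k \<ge> 1 \<and> (T ^^ k) f = f"] assms
  by (auto simp: map_periodic_def map_period_def)

text \<open>The remainder of a return time modulo the period is again a return time, and minimality
  of the period forces it to be 0.\<close>

lemma funpow_fixed_iff:
  assumes f: "map_periodic T f"
  shows "(T ^^ n) f = f \<longleftrightarrow> map_period T f dvd n"
proof
  define k where "k = map_period T f"
  note k = map_period[OF f, folded k_def]
  assume "(T ^^ n) f = f"
  then have *: "(T ^^ (n mod k)) f = f" using funpow_mod_eq[OF k(2)] by simp
  have "n mod k < k" using k by simp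
  then have "\<not> (n mod k \<ge> 1 \<and> (T ^^ (n mod k)) f = f)"
    unfolding k_def map_period_def by (rule not_less_Least)
  with * show "k dvd n" by (auto simp: Suc_le_eq)
next
  assume "map_period T f dvd n"
  then show "(T ^^ n) f = f" using funpow_mod_eq[OF map_period(2)[OF f], of n] by simp
qed

text \<open>On a cycle the relation is symmetric: \<open>f\<close> is also an iterate of
  \<open>g\<close>, so both points have the same return times and the same orbit.\<close>

lemma orbit_mem_periodic:
  assumes f: "map_periodic T f" and g: "g \<in> map_orbit T f"
  shows "map_periodic T g" "map_period T g = map_period T f" "map_orbit T g = map_orbit T f"
proof -
  obtain i where i: "g = (T ^^ i) f" using g by (auto simp: map_orbit_def)
  define k where "k = map_period T f"
  have k: "k \<ge> 1" using map_period[OF f] by (simp add: k_def)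
  \<comment> \<open>The choice makes \<open>j + i\<close> a multiple of the period, so
    \<open>j\<close> further steps lead from \<open>g\<close> back to \<open>f\<close>.\<close>
  define j where "j = k * i - i"
  have "j + i = k * i" using k by (simp add: j_def)
  then have "(T ^^ (j + i)) f = f" using funpow_fixed_iff[OF f, of "j + i"] by (simp add: k_def)
  then have j: "f = (T ^^ j) g" by (simp add: i funpow_add)
  have comm: "(T ^^ m) ((T ^^ l) h) = (T ^^ l) ((T ^^ m) h)" for m l h
    by (metis add.commute comp_apply funpow_add)
  have "(T ^^ m) g = g \<longleftrightarrow> (T ^^ m) f = f" for m
    using i j comm by metis
  then show "map_periodic T g" "map_period T g = map_period T f"
    using f by (auto simp: map_periodic_def map_period_def)
  have sub: "map_orbit T ((T ^^ l) h) \<subseteq> map_orbit T h" for l h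
    by (auto simp: map_orbit_def) (metis comp_apply funpow_add rangeI)
  show "map_orbit T g = map_orbit T f"
    using sub[of i f, folded i] sub[of j g, folded j] by (rule subset_antisym)
qed

lemma card_map_orbit:
  assumes f: "map_periodic T f"
  shows "card (map_orbit T f) = map_period T f"
proof -
  define k where "k = map_period T f"
  note k = map_period[OF f, folded k_def]
  have eq: "map_orbit T f = (\<lambda>i. (T ^^ i) f) ` {..<k}"
  proof -
    have "(T ^^ i) f \<in> (\<lambda>i. (T ^^ i) f) ` {..<k}" for i
      using funpow_mod_eq[OF k(2), of i] k(1) by (intro image_eqI[of _ _ "i mod k"]) auto
    then show ?thesis by (auto simp: map_orbit_def)
  qed
  have "(T ^^ i) f \<noteq> (T ^^ j) f" if ij: "i < j" "j < k" for i j
  proof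
    assume "(T ^^ i) f = (T ^^ j) f"
    \<comment> \<open>Applying \<open>k - j\<close> more steps turns a coincidence into a return
      time \<open>k - j + i\<close> strictly between 0 and \<open>k\<close>.\<close>
    then have "(T ^^ (k - j + i)) f = (T ^^ (k - j + j)) f" by (simp add: funpow_add del: le_add_diff_inverse2)
    also have "\<dots> = f" using k ij by simp
    finally have "k dvd k - j + i" using funpow_fixed_iff[OF f] by (simp add: k_def)
    then have "k \<le> k - j + i" using ij by (intro dvd_imp_le) auto
    with ij show False by simp
  qed
  then have "inj_on (\<lambda>i. (T ^^ i) f) {..<k}" by (intro linorder_inj_onI) auto
  then show ?thesis by (simp add: eq card_image k_def)
qed

lemma Union_map_cycles: "\<Union> (map_cycles T d) = {f. map_periodic T f \<and> map_period T f = d}"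
proof -
  have mem: "f \<in> map_orbit T f" for f
    unfolding map_orbit_def by (rule range_eqI[of _ _ 0]) simp
  have "g \<in> {f. map_periodic T f \<and> map_period T f = d}" if g: "g \<in> \<Union> (map_cycles T d)" for g
  proof -
    obtain f where "map_periodic T f" "map_period T f = d" "g \<in> map_orbit T f"
      using g unfolding map_cycles_def by blast
    then show ?thesis using orbit_mem_periodic(1,2)[of T f g] by simp
  qed
  moreover have "g \<in> \<Union> (map_cycles T d)" if "map_periodic T g" "map_period T g = d" for g
    using that mem[of g] by (auto simp: map_cycles_def)
  ultimately show ?thesis by blast
qed

lemma finite_map_cycles:
  assumes "finite {f. (T ^^ n) f = f}"
  shows "finite (map_cycles T n)"
proof (rule finite_UnionD, rule finite_subset[OF _ assms])
  show "\<Union> (map_cycles T n) \<subseteq> {f. (T ^^ n) f = f}"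
    unfolding Union_map_cycles by (auto simp: funpow_fixed_iff)
qed

text \<open>The fixed points of the \<open>n\<close>-th iterate are sorted by their period, a
  divisor \<open>d\<close> of \<open>n\<close>; those of period \<open>d\<close> split into disjoint
  cycles of \<open>d\<close> points each.\<close>

lemma card_fixed_eq_sum_map_cycles:
  assumes n: "n \<ge> 1" and fin: "finite {f. (T ^^ n) f = f}"
  shows "card {f. (T ^^ n) f = f} = (\<Sum>d | d dvd n. d * card (map_cycles T d))"
proof -
  have eq: "{f. (T ^^ n) f = f} = (\<Union>d\<in>{d. d dvd n}. \<Union> (map_cycles T d))"
  proof -
    have "map_periodic T f" if "(T ^^ n) f = f" for f
      unfolding map_periodic_def using that n by blast
    then have "(T ^^ n) f = f \<longleftrightarrow> map_periodic T f \<and> map_period T f dvd n" for f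
      using funpow_fixed_iff[of T f n] by blast
    then show ?thesis unfolding Union_map_cycles by auto
  qed
  have finU: "finite (\<Union> (map_cycles T d))" if "d dvd n" for d
    by (rule finite_subset[OF _ fin]) (unfold eq, use that in blast)
  have "card (\<Union> (map_cycles T d)) = d * card (map_cycles T d)" if "d dvd n" for d
  proof (rule card_partition[symmetric])
    show "finite (map_cycles T d)" using finU[OF that] by (rule finite_UnionD)
    show "card c = d" if "c \<in> map_cycles T d" for c
      using that by (auto simp: map_cycles_def card_map_orbit)
    show "c1 \<inter> c2 = {}" if "c1 \<in> map_cycles T d" "c2 \<in> map_cycles T d" "c1 \<noteq> c2" for c1 c2
    proof (rule ccontr)
      assume "c1 \<inter> c2 \<noteq> {}"
      then obtain g where g: "g \<in> c1" "g \<in> c2" by auto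
      \<comment> \<open>A cycle is the orbit of any of its points, so a common point
        \<open>g\<close> determines it.\<close>
      have "map_orbit T g = c" if c: "c \<in> map_cycles T d" "g \<in> c" for c
      proof -
        obtain f where "map_periodic T f" "c = map_orbit T f" using c by (auto simp: map_cycles_def)
        with c show ?thesis using orbit_mem_periodic(3) by metis
      qed
      then have "c1 = c2" using that g by metis
      with that show False by simp
    qed
  qed (use finU that in blast)
  moreover have "card (\<Union>d\<in>{d. d dvd n}. \<Union> (map_cycles T d)) = (\<Sum>d | d dvd n. card (\<Union> (map_cycles T d)))"
  proof (rule card_UN_disjoint)
    show "\<forall>i\<in>{d. d dvd n}. \<forall>j\<in>{d. d dvd n}.
        i \<noteq> j \<longrightarrow> \<Union> (map_cycles T i) \<inter> \<Union> (map_cycles T j) = {}"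
      unfolding Union_map_cycles by auto
  qed (use n finU in simp_all)
  ultimately show ?thesis unfolding eq by simp
qed

section \<open>Closed walks\<close>

text \<open>The graph has the ring elements as vertices and an edge wherever at least one end is 0,
  including a loop at 0. The list records all \<open>n + 1\<close> vertices of a walk with
  \<open>n\<close> steps from \<open>z\<close> to \<open>y\<close>.\<close>

definition walks :: "nat \<Rightarrow> 'a::zero \<Rightarrow> 'a \<Rightarrow> 'a list set" where
  "walks n z y = {xs. length xs = Suc n \<and> xs ! 0 = z \<and> xs ! n = y \<and> (\<forall>i<n. xs ! i = 0 \<or> xs ! Suc i = 0)}"

lemma walks_0: "walks 0 z y = (if z = y then {[z]} else {})"
  by (auto simp: walks_def length_Suc_conv)

lemma walks_Suc: "walks (Suc n) z y = (\<Union>w\<in>{w. z = 0 \<or> w = 0}. (#) z ` walks n w y)"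
proof (intro equalityI subsetI)
  fix xs assume xs: "xs \<in> walks (Suc n) z y"
  then obtain x ys where xs_eq: "xs = x # ys" by (auto simp: walks_def length_Suc_conv)
  from xs have "ys \<in> walks n (ys ! 0) y" "z = 0 \<or> ys ! 0 = 0" "x = z"
    by (auto simp: walks_def xs_eq dest: spec[of _ 0] spec[of _ "Suc _"])
  then show "xs \<in> (\<Union>w\<in>{w. z = 0 \<or> w = 0}. (#) z ` walks n w y)" by (auto simp: xs_eq)
next
  fix xs assume "xs \<in> (\<Union>w\<in>{w. z = 0 \<or> w = 0}. (#) z ` walks n w y)"
  then obtain w ys where "z = 0 \<or> w = 0" "xs = z # ys" "ys \<in> walks n w y" by auto
  then show "xs \<in> walks (Suc n) z y"
    by (auto simp: walks_def nth_Cons split: nat.split)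
qed

lemma finite_walks: "finite (walks n z (y :: 'a::{zero,finite}))"
  by (rule finite_subset[OF _ finite_lists_length_eq[of UNIV "Suc n"]]) (auto simp: walks_def)

lemma card_walks_Suc:
  "card (walks (Suc n) z (y :: 'a::{zero,finite})) = (\<Sum>w | z = 0 \<or> w = 0. card (walks n w y))"
proof -
  have "card (walks (Suc n) z y) = (\<Sum>w | z = 0 \<or> w = 0. card ((#) z ` walks n w y))"
    unfolding walks_Suc
  proof (rule card_UN_disjoint)
    show "\<forall>w\<in>{w. z = 0 \<or> w = 0}. \<forall>w'\<in>{w. z = 0 \<or> w = 0}. w \<noteq> w' \<longrightarrow>
      (#) z ` walks n w y \<inter> (#) z ` walks n w' y = {}" by (auto simp: walks_def)
  qed (simp_all add: finite_walks)
  then show ?thesis by (simp add: card_image)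
qed

lemma card_walks_Suc_nonzero:
  "z \<noteq> 0 \<Longrightarrow> card (walks (Suc n) z (y :: 'a::{zero,finite})) = card (walks n 0 y)"
  by (simp add: card_walks_Suc)

lemma card_walks_Suc_zero:
  fixes y :: "'a::{zero,finite}"
  shows "card (walks (Suc n) 0 y) = card (walks n 0 y) + (\<Sum>w\<in>-{0}. card (walks n w y))"
proof -
  have "(\<Sum>w\<in>UNIV. card (walks n w y)) = card (walks n 0 y) + (\<Sum>w\<in>UNIV - {0}. card (walks n w y))"
    by (rule sum.remove) auto
  then show ?thesis by (simp add: card_walks_Suc Compl_eq_Diff_UNIV)
qed

text \<open>The first step from 0 either stays at 0 or goes to one of the
  \<open>CARD('a) - 1\<close> nonzero vertices, from which the second step must return to 0.\<close>

lemma card_walks_Suc_Suc: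
  fixes y :: "'a::{zero,finite}"
  shows "card (walks (Suc (Suc n)) 0 y) = card (walks (Suc n) 0 y) + (CARD('a) - 1) * card (walks n 0 y)"
  by (subst card_walks_Suc_zero) (simp add: card_walks_Suc_nonzero Compl_eq_Diff_UNIV card_Diff_singleton)

text \<open>This is the trace of the \<open>n\<close>-th power of the adjacency matrix. The
  \<open>itself\<close> argument only names the vertex type.\<close>

definition closed_walks :: "nat \<Rightarrow> 'a::{zero,finite} itself \<Rightarrow> nat" where
  "closed_walks n _ = (\<Sum>z\<in>UNIV. card (walks n z (z :: 'a)))"

text \<open>A closed walk based at a nonzero vertex \<open>z\<close> steps to 0 first, so what
  remains is a walk of length \<open>n\<close> from 0 to \<open>z\<close>. All counts thus concern
  walks starting at 0.\<close>

lemma closed_walks_Suc: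
  "closed_walks (Suc n) TYPE('a::{zero,finite}) =
     card (walks (Suc n) 0 (0 :: 'a)) + (\<Sum>z\<in>-{0}. card (walks n 0 (z :: 'a)))"
proof -
  have "closed_walks (Suc n) TYPE('a) =
      card (walks (Suc n) 0 (0 :: 'a)) + (\<Sum>z\<in>UNIV-{0}. card (walks (Suc n) z (z :: 'a)))"
    unfolding closed_walks_def by (rule sum.remove) auto
  then show ?thesis by (simp add: card_walks_Suc_nonzero Compl_eq_Diff_UNIV)
qed

lemma closed_walks_1: "closed_walks (Suc 0) TYPE('a::{zero,finite}) = 1"
  by (simp add: closed_walks_Suc card_walks_Suc_zero walks_0)

lemma closed_walks_2: "closed_walks (Suc (Suc 0)) TYPE('a::{zero,finite}) = 1 + 2 * (CARD('a) - 1)"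
proof -
  have "card (walks (Suc 0) 0 z) = 1" for z :: 'a
    by (cases "z = 0") (simp_all add: card_walks_Suc_zero walks_0 if_distrib cong: if_cong)
  moreover have "card (walks 0 0 (0::'a)) = 1" by (simp add: walks_0)
  ultimately have "closed_walks (Suc (Suc 0)) TYPE('a) = CARD('a) + (CARD('a) - 1)"
    by (simp add: closed_walks_Suc card_walks_Suc_Suc Compl_eq_Diff_UNIV card_Diff_singleton)
  moreover have "0 < CARD('a)" by simp
  ultimately show ?thesis by linarith
qed

text \<open>Each summand in \<open>closed_walks_Suc\<close> obeys the recurrence for walks from 0.
  It starts at \<open>n = 1\<close> because the trace at length 0 is the number of vertices, which
  does not fit in general.\<close>

lemma closed_walks_Suc_Suc:
  assumes "n \<ge> 1"
  shows "closed_walks (Suc (Suc n)) TYPE('a::{zero,finite}) =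
    closed_walks (Suc n) TYPE('a) + (CARD('a) - 1) * closed_walks n TYPE('a)"
proof -
  obtain m where "n = Suc m" using assms by (cases n) auto
  then show ?thesis
    by (simp add: closed_walks_Suc card_walks_Suc_Suc sum.distrib sum_distrib_left add_mult_distrib2)
qed

text \<open>The hypotheses say that \<alpha> and \<beta> are the roots of
  \<open>t^2 = t + (q - 1)\<close> with \<open>q = CARD('a)\<close>, the characteristic equation of
  the recurrence; lengths 1 and 2 are the initial values.\<close>

lemma closed_walks_eq:
  fixes \<alpha> \<beta> :: real
  assumes sum: "\<alpha> + \<beta> = 1" and prod: "\<alpha> * \<beta> = 1 - real CARD('a::{zero,finite})" and "n \<ge> 1"
  shows "real (closed_walks n TYPE('a)) = \<alpha> ^ n + \<beta> ^ n"
  using \<open>n \<ge> 1\<close>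
proof (induction n rule: less_induct)
  case (less n)
  have q: "real (CARD('a) - 1) = real CARD('a) - 1" by (simp add: of_nat_diff Suc_leI)
  have sq: "\<alpha> ^ 2 = \<alpha> + (real CARD('a) - 1)" "\<beta> ^ 2 = \<beta> + (real CARD('a) - 1)"
  proof -
    have \<beta>: "\<beta> = 1 - \<alpha>" using sum by simp
    show "\<alpha> ^ 2 = \<alpha> + (real CARD('a) - 1)" "\<beta> ^ 2 = \<beta> + (real CARD('a) - 1)"
      using prod unfolding \<beta> by (simp_all add: power2_eq_square algebra_simps)
  qed
  consider "n = Suc 0" | "n = Suc (Suc 0)" | m where "n = Suc (Suc m)" "m \<ge> 1"
    using less.prems by (metis One_nat_def Suc_leI not0_implies_Suc not_gr_zero not_less_eq_eq)
  then show ?case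
  proof cases
    case 1
    then show ?thesis using sum by (simp add: closed_walks_1)
  next
    case 2
    then show ?thesis using sum sq q by (simp add: closed_walks_2 power2_eq_square)
  next
    case (3 m)
    have "real (closed_walks n TYPE('a)) = \<alpha> ^ m * (\<alpha> + (real CARD('a) - 1)) + \<beta> ^ m * (\<beta> + (real CARD('a) - 1))"
      unfolding 3(1) closed_walks_Suc_Suc[OF 3(2)] of_nat_add of_nat_mult q
      using less.IH[of m] less.IH[of "Suc m"] 3 by (simp add: algebra_simps)
    then show ?thesis unfolding sq[symmetric] by (simp add: 3(1) power2_eq_square algebra_simps)
  qed
qed

section \<open>Periodic admissible sequences\<close>

definition admissible :: "(nat \<Rightarrow> 'a::zero) \<Rightarrow> bool" where
  "admissible a \<longleftrightarrow> (\<forall>i. a i = 0 \<or> a (Suc i) = 0)"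

lemma periodic_mod_eq:
  assumes "\<And>i. a (i + n) = a i"
  shows "a (i mod n) = a (i :: nat)"
proof -
  have "a (j + k * n) = a j" for j k
  proof (induction k)
    case (Suc k)
    have "a (j + Suc k * n) = a ((j + k * n) + n)" by (simp add: algebra_simps)
    then show ?case using assms Suc by simp
  qed simp
  from this[of "i mod n" "i div n"] show ?thesis by simp
qed

text \<open>One period of the sequence, with its first term repeated at the end, is a closed walk;
  conversely a closed walk is unrolled by reading its indices modulo \<open>n\<close>.\<close>

lemma bij_betw_admissible_closed_walks:
  assumes n: "n \<ge> 1"
  shows "bij_betw (\<lambda>a. map a [0..<Suc n]) {a :: nat \<Rightarrow> 'a::zero. (\<forall>i. a (i + n) = a i) \<and> admissible a}
    (\<Union>z. walks n z z)"
proof (rule bij_betw_byWitness[where f' = "\<lambda>xs i. xs ! (i mod n)"])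
  show "\<forall>a\<in>{a :: nat \<Rightarrow> 'a. (\<forall>i. a (i + n) = a i) \<and> admissible a}. (\<lambda>i. map a [0..<Suc n] ! (i mod n)) = a"
  proof (intro ballI ext)
    fix a :: "nat \<Rightarrow> 'a" and i
    assume a: "a \<in> {a. (\<forall>i. a (i + n) = a i) \<and> admissible a}"
    have "i mod n < Suc n" using n by (simp add: less_Suc_eq)
    then show "map a [0..<Suc n] ! (i mod n) = a i"
      using a periodic_mod_eq[of a n i] by (simp del: upt_Suc)
  qed
  show "\<forall>xs\<in>\<Union>z :: 'a. walks n z z. map (\<lambda>i. xs ! (i mod n)) [0..<Suc n] = xs"
  proof
    fix xs :: "'a list" assume "xs \<in> (\<Union>z. walks n z z)"
    then have xs: "length xs = Suc n" "xs ! n = xs ! 0" by (auto simp: walks_def)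
    then show "map (\<lambda>i. xs ! (i mod n)) [0..<Suc n] = xs"
      by (intro nth_equalityI) (auto simp: less_Suc_eq simp del: upt_Suc)
  qed
  show "(\<lambda>a. map a [0..<Suc n]) ` {a :: nat \<Rightarrow> 'a. (\<forall>i. a (i + n) = a i) \<and> admissible a} \<subseteq> (\<Union>z. walks n z z)"
  proof (rule image_subsetI)
    fix a :: "nat \<Rightarrow> 'a"
    assume a: "a \<in> {a. (\<forall>i. a (i + n) = a i) \<and> admissible a}"
    then have "a n = a 0" by (metis (mono_tags, lifting) add_0 mem_Collect_eq)
    with a have "map a [0..<Suc n] \<in> walks n (a 0) (a 0)"
      by (simp add: walks_def admissible_def del: upt_Suc)
    then show "map a [0..<Suc n] \<in> (\<Union>z. walks n z z)" by blast
  qed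
  show "(\<lambda>xs i. xs ! (i mod n)) ` (\<Union>z. walks n z z) \<subseteq> {a :: nat \<Rightarrow> 'a. (\<forall>i. a (i + n) = a i) \<and> admissible a}"
  proof (rule image_subsetI)
    fix xs :: "'a list" assume "xs \<in> (\<Union>z. walks n z z)"
    then have xs: "xs ! n = xs ! 0" "\<And>i. i < n \<Longrightarrow> xs ! i = 0 \<or> xs ! Suc i = 0"
      by (auto simp: walks_def)
    have "xs ! (i mod n) = 0 \<or> xs ! (Suc i mod n) = 0" for i
      \<comment> \<open>At the wrap-around, where \<open>Suc i mod n = 0\<close>, the last edge of
        the walk serves because \<open>xs ! n = xs ! 0\<close>.\<close>
      using xs(2)[of "i mod n"] xs(1) n by (auto simp: mod_Suc)
    then show "(\<lambda>i. xs ! (i mod n)) \<in> {a. (\<forall>i. a (i + n) = a i) \<and> admissible a}"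
      by (simp add: admissible_def)
  qed
qed

lemma card_periodic_admissible:
  assumes n: "n \<ge> 1"
  shows "finite {a :: nat \<Rightarrow> 'a::{zero,finite}. (\<forall>i. a (i + n) = a i) \<and> admissible a}"
    and "card {a :: nat \<Rightarrow> 'a::{zero,finite}. (\<forall>i. a (i + n) = a i) \<and> admissible a} = closed_walks n TYPE('a)"
proof -
  note bij = bij_betw_admissible_closed_walks[OF n, where 'a = 'a]
  show "finite {a :: nat \<Rightarrow> 'a. (\<forall>i. a (i + n) = a i) \<and> admissible a}"
    using bij_betw_finite[OF bij] by (simp add: finite_walks)
  have "card (\<Union>z :: 'a. walks n z z) = (\<Sum>z\<in>UNIV. card (walks n z (z :: 'a)))"
    by (rule card_UN_disjoint) (simp_all add: finite_walks, auto simp: walks_def)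
  then show "card {a :: nat \<Rightarrow> 'a. (\<forall>i. a (i + n) = a i) \<and> admissible a} = closed_walks n TYPE('a)"
    using bij_betw_same_card[OF bij] by (simp add: closed_walks_def)
qed

section \<open>Itineraries\<close>

lemma funpow_collatz_Suc: "(collatz ^^ Suc i) f = (collatz ^^ i) (collatz f)"
  by (simp add: funpow_swap1)

definition itinerary :: "'a::comm_ring_1 fps \<Rightarrow> nat \<Rightarrow> 'a" where
  "itinerary f i = fps_nth ((collatz ^^ i) f) 0"

lemma itinerary_0: "itinerary f 0 = fps_nth f 0"
  by (simp add: itinerary_def)

lemma itinerary_Suc: "itinerary f (Suc i) = itinerary (collatz f) i"
  by (simp only: itinerary_def funpow_collatz_Suc)

lemma collatz_nonzero:
  assumes "fps_nth f 0 \<noteq> 0"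
  shows "collatz f = (fps_X + 1) * f - fps_const (fps_nth f 0)" "fps_nth (collatz f) 0 = 0"
  using assms by (simp_all add: collatz_def)

text \<open>A step at a nonzero constant coefficient subtracts that coefficient, so the next one is
  0.\<close>

lemma admissible_itinerary: "admissible (itinerary f)"
  unfolding admissible_def
  by (auto simp: itinerary_def dest: collatz_nonzero)

text \<open>If \<open>F\<close> is the series with itinerary \<open>a\<close> and \<open>a 0 \<noteq> 0\<close>, then two Collatz steps give
  \<open>(1 + x) F = a 0 + x G\<close>, where \<open>G\<close> is the series of \<open>a\<close> shifted twice.\<close>

primrec series_coeff :: "nat \<Rightarrow> (nat \<Rightarrow> 'a::comm_ring_1) \<Rightarrow> 'a" where
  "series_coeff 0 a = a 0"
| "series_coeff (Suc m) a = (if a 0 = 0 then series_coeff m (\<lambda>i. a (Suc i))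
     else series_coeff m (\<lambda>i. a (Suc (Suc i))) - series_coeff m a)"

definition series_of_itinerary :: "(nat \<Rightarrow> 'a::comm_ring_1) \<Rightarrow> 'a fps" where
  "series_of_itinerary a = Abs_fps (\<lambda>m. series_coeff m a)"

text \<open>If the constant coefficient is nonzero, two Collatz steps shift
  \<open>(fps_X + 1) * f\<close> down by one, so coefficient \<open>m\<close> of the result is the
  sum of coefficients \<open>m\<close> and \<open>Suc m\<close> of \<open>f\<close>. The recursion
  solves this for the latter.\<close>

lemma series_coeff_itinerary: "series_coeff m (itinerary f) = fps_nth f m"
proof (induction m arbitrary: f)
  case 0
  show ?case by (simp add: itinerary_0)
next
  case (Suc m)
  have shift: "(\<lambda>i. itinerary f (Suc i)) = itinerary (collatz f)" for f :: "'a fps"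
    by (simp add: itinerary_Suc)
  show ?case
  proof (cases "fps_nth f 0 = 0")
    case True
    then show ?thesis by (simp add: shift Suc itinerary_0 collatz_def)
  next
    case False
    have "collatz (collatz f) = fps_shift 1 ((fps_X + 1) * f - fps_const (fps_nth f 0))"
      using collatz_nonzero[OF False] by (simp add: collatz_def)
    with False show ?thesis
      by (simp add: itinerary_Suc shift Suc itinerary_0 distrib_right)
  qed
qed

lemma series_of_itinerary_itinerary: "series_of_itinerary (itinerary f) = f"
  by (rule fps_ext) (simp add: series_of_itinerary_def series_coeff_itinerary)

lemma collatz_series_of_itinerary:
  assumes a: "admissible a"
  shows "collatz (series_of_itinerary a) = series_of_itinerary (\<lambda>i. a (Suc i))"
proof (rule fps_ext)
  fix m
  show "fps_nth (collatz (series_of_itinerary a)) m = fps_nth (series_of_itinerary (\<lambda>i. a (Suc i))) m"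
  proof (cases "a 0 = 0")
    case True
    then show ?thesis by (simp add: collatz_def series_of_itinerary_def)
  next
    case False
    \<comment> \<open>With \<open>a 1 = 0\<close> the recursion for the shifted sequence takes its
      zero branch, so the positive coefficients on both sides come from the doubly shifted sequence,
      while both constant coefficients are 0.\<close>
    with a have "a 1 = 0" by (auto simp: admissible_def)
    with False show ?thesis
      by (cases m) (simp_all add: collatz_def series_of_itinerary_def distrib_right)
  qed
qed

lemma funpow_collatz_series_of_itinerary:
  "admissible a \<Longrightarrow> (collatz ^^ n) (series_of_itinerary a) = series_of_itinerary (\<lambda>i. a (i + n))"
proof (induction n)
  case (Suc n)
  then have "admissible (\<lambda>i. a (i + n))" by (simp add: admissible_def)
  from collatz_series_of_itinerary[OF this] Suc show ?case by simp
qed simp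

lemma itinerary_series_of_itinerary:
  "admissible a \<Longrightarrow> itinerary (series_of_itinerary a) = a"
  by (rule ext) (simp add: itinerary_def funpow_collatz_series_of_itinerary, simp add: series_of_itinerary_def)

text \<open>The conjugacy carries the \<open>n\<close>-th Collatz iterate to the shift by
  \<open>n\<close>, hence fixed points to \<open>n\<close>-periodic admissible sequences.\<close>

lemma bij_betw_itinerary:
  "bij_betw itinerary {f :: 'a::comm_ring_1 fps. (collatz ^^ n) f = f} {a. (\<forall>i. a (i + n) = a i) \<and> admissible a}"
proof (rule bij_betw_byWitness[where f' = series_of_itinerary])
  show "itinerary ` {f :: 'a fps. (collatz ^^ n) f = f} \<subseteq> {a. (\<forall>i. a (i + n) = a i) \<and> admissible a}"
    by (auto simp: admissible_itinerary) (simp add: itinerary_def funpow_add)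
qed (auto simp: series_of_itinerary_itinerary itinerary_series_of_itinerary funpow_collatz_series_of_itinerary)

lemma card_fixed_collatz:
  fixes \<alpha> \<beta> :: real
  assumes "\<alpha> + \<beta> = 1" "\<alpha> * \<beta> = 1 - real CARD('a::{comm_ring_1,finite})" "n \<ge> 1"
  shows "finite {f :: 'a fps. (collatz ^^ n) f = f}"
    and "real (card {f :: 'a fps. (collatz ^^ n) f = f}) = \<alpha> ^ n + \<beta> ^ n"
  using bij_betw_finite[OF bij_betw_itinerary[of n, where 'a = 'a]] card_periodic_admissible[OF assms(3), where 'a = 'a]
    bij_betw_same_card[OF bij_betw_itinerary[of n, where 'a = 'a]] closed_walks_eq[OF assms]
  by simp_all

section \<open>Rational series\<close>

text \<open>The denominator is cleared so that polynomial identities for \<open>f\<close> can be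
  composed without inverting series.\<close>

definition rational_series :: "'a::comm_ring_1 fps \<Rightarrow> bool" where
  "rational_series f \<longleftrightarrow> (\<exists>u v. (1 + fps_X * fps_of_poly v) * f = fps_of_poly u)"

lemma rational_series_altdef:
  "rational_series f \<longleftrightarrow> (\<exists>u v. f = fps_of_poly u * one_plus_X_mult_inverse v)"
proof -
  have "D * f = p \<longleftrightarrow> f = p * E" if "D * E = 1" for D E p :: "'a fps"
  proof
    assume p: "D * f = p"
    have "p * E = D * E * f" unfolding p[symmetric] by (simp add: mult_ac)
    with that show "f = p * E" by simp
  next
    assume "f = p * E"
    then have "D * f = p * (D * E)" by (simp add: mult_ac)
    with that show "D * f = p" by simp
  qed
  from this[OF one_plus_X_mult_inverse] show ?thesis by (simp add: rational_series_def)
qed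

lemma fps_X_eq_of_poly: "fps_X = fps_of_poly [:0, 1:]"
  by (simp add: fps_of_poly_pCons)

text \<open>A step is undone by \<open>f = fps_X * collatz f\<close> or by
  \<open>(fps_X + 1) * f = collatz f + fps_const c\<close>, where \<open>c\<close> is the constant
  coefficient of \<open>f\<close>. The factor \<open>fps_X + 1\<close> joins the denominator, which
  keeps constant coefficient 1. The given \<open>v\<close> lets a relation already known for
  \<open>collatz f\<close> be inserted.\<close>

lemma collatz_step_inverse:
  "\<exists>v' s p. (1 + fps_X * fps_of_poly v') * f =
     fps_of_poly s * ((1 + fps_X * fps_of_poly v) * collatz f) + fps_of_poly p"
proof (cases "fps_nth f 0 = 0")
  case True
  have "(1 + fps_X * fps_of_poly v) * f = (1 + fps_X * fps_of_poly v) * (fps_X * collatz f)"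
    by (simp only: fps_X_mult_collatz[OF True])
  also have "\<dots> = fps_of_poly [:0, 1:] * ((1 + fps_X * fps_of_poly v) * collatz f) + fps_of_poly 0"
    by (simp only: fps_X_eq_of_poly mult.left_commute fps_of_poly_0 add_0_right)
  finally show ?thesis by blast
next
  case False
  define c where "c = fps_nth f 0"
  define D where "D = 1 + fps_X * fps_of_poly v"
  have step: "(fps_X + 1) * f = collatz f + fps_const c"
    using collatz_nonzero(1)[OF False] by (simp add: c_def)
  \<comment> \<open>The new \<open>v'\<close> is read off from
    \<open>(1 + x v) (1 + x) = 1 + x (1 + v + x v)\<close>.\<close>
  have "1 + fps_X * fps_of_poly (1 + v + [:0, 1:] * v) = D * (fps_X + 1)"
    unfolding D_def fps_of_poly_add fps_of_poly_mult fps_X_eq_of_poly[symmetric] by (simp add: algebra_simps)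
  then have "(1 + fps_X * fps_of_poly (1 + v + [:0, 1:] * v)) * f = D * ((fps_X + 1) * f)"
    by (simp only: mult.assoc)
  also have "\<dots> = fps_of_poly 1 * (D * collatz f) + D * fps_const c"
    unfolding step by (simp add: distrib_left)
  also have "D * fps_const c = fps_of_poly ((1 + [:0, 1:] * v) * [:c:])"
    by (simp only: D_def fps_X_eq_of_poly fps_of_poly_mult fps_of_poly_add fps_of_poly_1 fps_of_poly_const)
  finally show ?thesis unfolding D_def by blast
qed

lemma rational_series_collatzD:
  assumes "rational_series (collatz f)"
  shows "rational_series f"
proof -
  from assms obtain u v where uv: "(1 + fps_X * fps_of_poly v) * collatz f = fps_of_poly u"
    by (auto simp: rational_series_def)
  obtain v' s p where "(1 + fps_X * fps_of_poly v') * f = fps_of_poly s * fps_of_poly u + fps_of_poly p"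
    using collatz_step_inverse[of f v] unfolding uv by blast
  then have "(1 + fps_X * fps_of_poly v') * f = fps_of_poly (s * u + p)"
    by (simp only: fps_of_poly_add fps_of_poly_mult)
  then show ?thesis unfolding rational_series_def by blast
qed

lemma rational_series_funpow_collatzD:
  "rational_series ((collatz ^^ m) f) \<Longrightarrow> rational_series f"
  by (induction m) (auto dest: rational_series_collatzD)

text \<open>The inverse steps are composed along the orbit: the relation for
  \<open>collatz f\<close> is inserted into the one expressing \<open>f\<close> through
  \<open>collatz f\<close>.\<close>

lemma funpow_collatz_affine:
  "\<exists>v w p. (1 + fps_X * fps_of_poly v) * f = fps_of_poly w * (collatz ^^ k) f + fps_of_poly p"
proof (induction k arbitrary: f)
  case 0
  have "(1 + fps_X * fps_of_poly 0) * f = fps_of_poly 1 * (collatz ^^ 0) f + fps_of_poly 0" by simp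
  then show ?case by blast
next
  case (Suc k)
  obtain v w p where IH: "(1 + fps_X * fps_of_poly v) * collatz f
      = fps_of_poly w * (collatz ^^ Suc k) f + fps_of_poly p"
    using Suc[of "collatz f"] unfolding funpow_collatz_Suc by blast
  obtain v' s p' where "(1 + fps_X * fps_of_poly v') * f
      = fps_of_poly s * (fps_of_poly w * (collatz ^^ Suc k) f + fps_of_poly p) + fps_of_poly p'"
    using collatz_step_inverse[of f v] unfolding IH by blast
  then have "(1 + fps_X * fps_of_poly v') * f
      = fps_of_poly (s * w) * (collatz ^^ Suc k) f + fps_of_poly (s * p + p')"
    by (simp only: fps_of_poly_add fps_of_poly_mult distrib_left mult.assoc add.assoc)
  then show ?case by blast
qed

text \<open>Starting where the constant coefficient vanishes puts a factor \<open>x\<close> in front of the right-hand side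
  of the affine relation, so that the resulting denominator is of the form \<open>1 + x v\<close>.\<close>

lemma rational_series_if_periodic_zero:
  assumes f: "map_periodic collatz f" and zero: "fps_nth f 0 = 0"
  shows "rational_series f"
proof -
  \<comment> \<open>With the first step split off, \<open>j\<close> is one less than a period and
    leads from \<open>collatz f\<close> back to \<open>f\<close>.\<close>
  obtain j where j: "(collatz ^^ j) (collatz f) = f"
  proof -
    from f obtain k where k: "k \<ge> 1" "(collatz ^^ k) f = f" by (auto simp: map_periodic_def)
    then have "(collatz ^^ Suc (k - 1)) f = f" by simp
    then show ?thesis unfolding funpow_collatz_Suc by (rule that)
  qed
  obtain v w p where *: "(1 + fps_X * fps_of_poly v) * collatz f = fps_of_poly w * f + fps_of_poly p"
    using funpow_collatz_affine[of "collatz f" j] unfolding j by blast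
  have "(1 + fps_X * fps_of_poly v) * (fps_X * collatz f) = fps_X * ((1 + fps_X * fps_of_poly v) * collatz f)"
    by (rule mult.left_commute)
  then have "(1 + fps_X * fps_of_poly v) * f = fps_X * (fps_of_poly w * f + fps_of_poly p)"
    unfolding fps_X_mult_collatz[OF zero] * .
  then have "(1 + fps_X * fps_of_poly (v - w)) * f = fps_of_poly ([:0, 1:] * p)"
    unfolding fps_of_poly_mult fps_of_poly_diff fps_X_eq_of_poly[symmetric] by (simp add: algebra_simps)
  then show ?thesis unfolding rational_series_def by blast
qed

lemma map_periodic_step: "map_periodic T f \<Longrightarrow> map_periodic T (T f)"
  unfolding map_periodic_def by (metis funpow_swap1)

text \<open>Rationality pulls back along the Collatz map, so a single point of the cycle with zero
  constant coefficient suffices; the point reached or its successor is one.\<close>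

lemma rational_series_if_eventually_periodic:
  assumes "eventually_map_periodic collatz f"
  shows "rational_series f"
proof -
  obtain m where m: "map_periodic collatz ((collatz ^^ m) f)"
    using assms by (auto simp: eventually_map_periodic_def)
  define g where "g = (collatz ^^ m) f"
  have "rational_series g"
  proof (cases "fps_nth g 0 = 0")
    case True
    with m show ?thesis by (simp add: g_def rational_series_if_periodic_zero)
  next
    case False
    then have "fps_nth (collatz g) 0 = 0" by (rule collatz_nonzero(2))
    with m have "rational_series (collatz g)"
      by (intro rational_series_if_periodic_zero map_periodic_step) (simp_all add: g_def)
    then show ?thesis by (rule rational_series_collatzD)
  qed
  then show ?thesis unfolding g_def by (rule rational_series_funpow_collatzD)
qed

section \<open>Finite orbits of rational series\<close>

text \<open>By the pigeonhole principle two iterates agree, and the difference of their indices is a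
  return time of the earlier one.\<close>

lemma eventually_periodic_if_finite_invariant:
  assumes fin: "finite B" and f: "f \<in> B" and inv: "\<And>g. g \<in> B \<Longrightarrow> T g \<in> B"
  shows "eventually_map_periodic T f"
proof -
  have "(T ^^ i) f \<in> B" for i by (induction i) (use f inv in auto)
  then have "finite (range (\<lambda>i. (T ^^ i) f))" using fin by (blast intro: finite_subset)
  then have "\<not> inj (\<lambda>i. (T ^^ i) f)" using finite_imageD infinite_UNIV_nat by blast
  then obtain i j where ij: "i < j" "(T ^^ i) f = (T ^^ j) f"
    using linorder_injI[of "\<lambda>i. (T ^^ i) f"] by blast
  have "(T ^^ (j - i)) ((T ^^ i) f) = (T ^^ i) f"
    using ij by (metis comp_apply funpow_add le_add_diff_inverse2 less_imp_le)
  moreover have "j - i \<ge> 1" using ij by simp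
  ultimately show ?thesis unfolding eventually_map_periodic_def map_periodic_def by blast
qed

lemma finite_polys_degree_le: "finite {p :: 'a::{zero,finite} poly. degree p \<le> N}"
proof (rule finite_subset)
  show "{p :: 'a poly. degree p \<le> N} \<subseteq> Poly ` {xs. set xs \<subseteq> UNIV \<and> length xs = Suc N}"
  proof
    fix p :: "'a poly" assume "p \<in> {p. degree p \<le> N}"
    then have "p = Poly (map (coeff p) [0..<Suc N])"
      by (intro poly_eqI) (auto simp: coeff_Poly_eq nth_default_def coeff_eq_0 simp del: upt_Suc)
    then show "p \<in> Poly ` {xs. set xs \<subseteq> UNIV \<and> length xs = Suc N}"
      by (rule image_eqI) simp
  qed
qed (rule finite_imageI[OF finite_lists_length_eq[OF finite]])

lemma eventually_periodic_if_rational_series: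
  fixes f :: "'a::{comm_ring_1,finite} fps"
  assumes "rational_series f"
  shows "eventually_map_periodic collatz f"
proof -
  obtain u v where f: "f = fps_of_poly u * one_plus_X_mult_inverse v"
    using assms by (auto simp: rational_series_altdef)
  define D where "D = 1 + [:0, 1:] * v"
  define E where "E = one_plus_X_mult_inverse v"
  have DE: "fps_of_poly D * E = 1"
    using one_plus_X_mult_inverse[of v]
    by (simp only: D_def E_def fps_of_poly_add fps_of_poly_mult fps_of_poly_1 fps_X_eq_of_poly)
  have D0: "coeff D 0 = 1" by (simp add: D_def)
  from arg_cong[OF DE, of "\<lambda>f. fps_nth f 0"] have E0: "fps_nth E 0 = 1"
    by (simp add: D0)
  \<comment> \<open>The bound includes \<open>degree D\<close> because multiples of \<open>D\<close>
    get subtracted from numerators.\<close>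
  define N where "N = max (degree u) (degree D)"
  define A where "A = (\<lambda>p. fps_of_poly p * E) ` {p. degree p \<le> N}"
  \<comment> \<open>Multiplying by \<open>fps_X + 1\<close> may raise the degree of the numerator to
    \<open>N + 1\<close>, but the result is then divisible by \<open>fps_X\<close> and the next step
    removes that factor. Hence \<open>A\<close> with its multiples by \<open>fps_X\<close> is
    invariant.\<close>
  define B where "B = A \<union> (*) fps_X ` A"
  have lower: "\<exists>p'. p = [:0, 1:] * p' \<and> degree p' \<le> N" if "coeff p 0 = 0" "degree p \<le> Suc N" for p :: "'a poly"
  proof (cases p)
    case (pCons c p')
    with that have "p = [:0, 1:] * p'" "degree p' \<le> N" by (auto split: if_splits)
    then show ?thesis by blast
  qed
  have of_X: "fps_of_poly ([:0, 1:] * p) * E = fps_X * (fps_of_poly p * E)" for p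
    by (simp only: fps_of_poly_mult fps_X_eq_of_poly mult.assoc)
  have shift_X: "fps_shift 1 (fps_X * g) = g" for g :: "'a fps"
    by (rule fps_ext) simp
  have "collatz g \<in> B" if "g \<in> A" for g
  proof -
    obtain p where p: "g = fps_of_poly p * E" "degree p \<le> N" using \<open>g \<in> A\<close> by (auto simp: A_def)
    have g0: "fps_nth g 0 = coeff p 0" by (simp add: p E0)
    show ?thesis
    proof (cases "coeff p 0 = 0")
      case True
      with lower[of p] p obtain p' where p': "p = [:0, 1:] * p'" "degree p' \<le> N" by auto
      have "collatz g = fps_shift 1 (fps_X * (fps_of_poly p' * E))"
        unfolding of_X[symmetric] p'(1)[symmetric] p(1)[symmetric] using True g0 by (simp add: collatz_def)
      then have "collatz g = fps_of_poly p' * E" by (simp only: shift_X)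
      with p' show ?thesis by (auto simp: B_def A_def)
    next
      case False
      \<comment> \<open>This is the numerator of \<open>collatz g\<close> over the denominator
        \<open>D\<close>; its constant coefficient vanishes because that of \<open>D\<close> is
        1.\<close>
      define r where "r = [:1, 1:] * p - [:coeff p 0:] * D"
      have "degree ([:1, 1:] * p) \<le> Suc N"
        using degree_mult_le[of "[:1, 1:]" p] p(2) by simp
      moreover have "degree ([:coeff p 0:] * D) \<le> Suc N"
        using degree_mult_le[of "[:coeff p 0:]" D] by (simp add: N_def)
      ultimately have "degree r \<le> Suc N" unfolding r_def by (rule degree_diff_le)
      moreover have "coeff r 0 = 0" by (simp add: r_def coeff_mult D0)
      ultimately obtain r' where r': "r = [:0, 1:] * r'" "degree r' \<le> N" using lower by blast
      have X1: "fps_of_poly [:1, 1:] = (fps_X + 1 :: 'a fps)" by (simp add: fps_of_poly_pCons)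
      have "fps_of_poly r * E = (fps_X + 1) * g - fps_const (coeff p 0) * (fps_of_poly D * E)"
        unfolding r_def fps_of_poly_diff fps_of_poly_mult fps_of_poly_const p(1) X1 by (simp add: algebra_simps)
      also have "\<dots> = collatz g" using False g0 by (simp add: collatz_def DE)
      finally have "collatz g = fps_X * (fps_of_poly r' * E)" by (simp only: r'(1) of_X)
      with r' show ?thesis by (auto simp: B_def A_def)
    qed
  qed
  moreover have "collatz (fps_X * g) = g" for g :: "'a fps"
    by (simp add: collatz_def shift_X del: One_nat_def)
  ultimately have "\<And>g. g \<in> B \<Longrightarrow> collatz g \<in> B" by (auto simp: B_def)
  moreover have "f \<in> B" by (auto simp: B_def A_def f N_def E_def)
  moreover have "finite B" by (simp add: B_def A_def finite_polys_degree_le)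
  ultimately show ?thesis by (intro eventually_periodic_if_finite_invariant[of B])
qed

section \<open>Asymptotics\<close>

text \<open>The divisor 1 contributes \<alpha>^n + \<beta>^n. At most \<open>n\<close> other
  divisors remain, each contributing at most 2 \<alpha>^(n/2), which is negligible against
  \<alpha>^n even after summing.\<close>

lemma asymp_equiv_moebius_sum:
  fixes \<alpha> \<beta> :: real and Z :: "nat \<Rightarrow> real"
  assumes \<alpha>: "\<alpha> > 1" and \<beta>: "\<bar>\<beta>\<bar> < \<alpha>"
    and Z: "\<And>n. n \<ge> 1 \<Longrightarrow> real n * Z n =
      (\<Sum>d | d dvd n. real_of_int (moebius d) * (\<alpha> ^ (n div d) + \<beta> ^ (n div d)))"
  shows "Z \<sim>[at_top] (\<lambda>n. \<alpha> ^ n / real n)"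
proof (rule asymp_equivI')
  \<comment> \<open>The root expresses \<alpha>^(n/2) as \<open>s ^ n\<close>, also for odd
    \<open>n\<close>.\<close>
  define s where "s = sqrt \<alpha>"
  have s: "s > 1" "s ^ 2 = \<alpha>" using \<alpha> by (simp_all add: s_def)
  have bound: "\<bar>Z n / (\<alpha> ^ n / real n) - 1\<bar> \<le> (\<bar>\<beta>\<bar> / \<alpha>) ^ n + 2 * (real n * (1 / s) ^ n)"
    if n: "n \<ge> 1" for n
  proof -
    define D where "D = {d. d dvd n} - {1}"
    have fin: "finite {d. d dvd n}" using n by simp
    have "D \<subseteq> {2..n}"
    proof
      fix d assume "d \<in> D"
      then have "d dvd n" "d \<noteq> 1" by (auto simp: D_def)
      moreover have "d \<noteq> 0" "d \<le> n" using \<open>d dvd n\<close> n by (auto dest: dvd_imp_le intro: ccontr)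
      ultimately show "d \<in> {2..n}" by simp
    qed
    then have D: "finite D" "card D \<le> n" "\<And>d. d \<in> D \<Longrightarrow> d \<ge> 2"
      using card_mono[of "{2..n}" D] by (auto intro: finite_subset)
    have term_bound: "\<bar>real_of_int (moebius d) * (\<alpha> ^ (n div d) + \<beta> ^ (n div d))\<bar> \<le> 2 * s ^ n"
      if d: "d \<in> D" for d
    proof -
      define m where "m = n div d"
      \<comment> \<open>Since \<open>d\<close> is at least 2, the exponent \<open>m\<close> is at
        most half of \<open>n\<close>.\<close>
      have "2 * m \<le> d * m" using D(3)[OF d] by (rule mult_right_mono) simp
      also have "d * m \<le> n" by (simp add: m_def)
      finally have "s ^ (2 * m) \<le> s ^ n" using s by (intro power_increasing) auto
      then have "\<alpha> ^ m \<le> s ^ n" by (simp add: power_mult s)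
      moreover have "\<bar>\<beta>\<bar> ^ m \<le> \<alpha> ^ m" using \<beta> by (intro power_mono) auto
      moreover have "\<bar>\<alpha> ^ m + \<beta> ^ m\<bar> \<le> \<alpha> ^ m + \<bar>\<beta>\<bar> ^ m"
        using abs_triangle_ineq[of "\<alpha> ^ m" "\<beta> ^ m"] \<alpha> by (simp add: power_abs)
      ultimately have "\<bar>\<alpha> ^ m + \<beta> ^ m\<bar> \<le> 2 * s ^ n" by linarith
      moreover have "\<bar>real_of_int (moebius d)\<bar> \<le> 1" by (simp add: moebius_def power_abs)
      ultimately have "\<bar>real_of_int (moebius d)\<bar> * \<bar>\<alpha> ^ m + \<beta> ^ m\<bar> \<le> 1 * (2 * s ^ n)"
        by (intro mult_mono) auto
      then show ?thesis by (simp add: abs_mult m_def)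
    qed
    have "real n * Z n = (\<alpha> ^ n + \<beta> ^ n) +
        (\<Sum>d\<in>D. real_of_int (moebius d) * (\<alpha> ^ (n div d) + \<beta> ^ (n div d)))"
      unfolding Z[OF n] D_def using fin by (subst sum.remove[of _ 1]) (auto simp: moebius_def)
    moreover have "\<bar>\<Sum>d\<in>D. real_of_int (moebius d) * (\<alpha> ^ (n div d) + \<beta> ^ (n div d))\<bar> \<le> (\<Sum>d\<in>D. 2 * s ^ n)"
      by (rule order.trans[OF sum_abs sum_mono]) (rule term_bound)
    moreover have "(\<Sum>d\<in>D. 2 * s ^ n) \<le> real n * (2 * s ^ n)"
      using D(2) s by (simp add: mult_right_mono)
    moreover have "\<bar>\<beta> ^ n\<bar> = \<bar>\<beta>\<bar> ^ n" by (simp add: power_abs)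
    ultimately have "\<bar>real n * Z n - \<alpha> ^ n\<bar> \<le> \<bar>\<beta>\<bar> ^ n + real n * (2 * s ^ n)" by linarith
    then have "\<bar>real n * Z n - \<alpha> ^ n\<bar> / \<alpha> ^ n \<le> (\<bar>\<beta>\<bar> ^ n + real n * (2 * s ^ n)) / \<alpha> ^ n"
      using \<alpha> by (intro divide_right_mono) auto
    moreover have "Z n / (\<alpha> ^ n / real n) - 1 = (real n * Z n - \<alpha> ^ n) / \<alpha> ^ n"
      using \<alpha> by (simp add: field_simps)
    moreover have "s ^ n / \<alpha> ^ n = (1 / s) ^ n"
      using s by (simp add: power_mult_distrib power2_eq_square power_divide flip: s(2))
    moreover have "(\<bar>\<beta>\<bar> ^ n + real n * (2 * s ^ n)) / \<alpha> ^ n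
        = (\<bar>\<beta>\<bar> / \<alpha>) ^ n + 2 * (real n * (s ^ n / \<alpha> ^ n))"
      by (simp add: add_divide_distrib power_divide)
    ultimately show ?thesis using \<alpha> by simp
  qed
  have "(\<lambda>n. (\<bar>\<beta>\<bar> / \<alpha>) ^ n) \<longlonglongrightarrow> 0"
    using \<alpha> \<beta> by (intro LIMSEQ_power_zero) simp
  moreover have "(\<lambda>n. real n * (1 / s) ^ n) \<longlonglongrightarrow> 0"
    using powser_times_n_limit_0[of "1 / s"] s(1) by simp
  ultimately have "(\<lambda>n. (\<bar>\<beta>\<bar> / \<alpha>) ^ n + 2 * (real n * (1 / s) ^ n)) \<longlonglongrightarrow> 0 + 2 * 0"
    by (rule tendsto_add[OF _ tendsto_mult[OF tendsto_const]])
  then have "(\<lambda>n. (\<bar>\<beta>\<bar> / \<alpha>) ^ n + 2 * (real n * (1 / s) ^ n)) \<longlonglongrightarrow> 0" by simp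
  then have "(\<lambda>n. Z n / (\<alpha> ^ n / real n) - 1) \<longlonglongrightarrow> 0"
  proof (rule metric_tendsto_imp_tendsto)
    show "\<forall>\<^sub>F n in sequentially. dist (Z n / (\<alpha> ^ n / real n) - 1) 0
        \<le> dist ((\<bar>\<beta>\<bar> / \<alpha>) ^ n + 2 * (real n * (1 / s) ^ n)) 0"
      using eventually_ge_at_top[of 1]
    proof eventually_elim
      case (elim n)
      from bound[OF elim] show ?case unfolding dist_0_norm dist_commute[of _ 0] real_norm_def by linarith
    qed
  qed
  then show "(\<lambda>n. Z n / (\<alpha> ^ n / real n)) \<longlonglongrightarrow> 1" by (simp add: LIM_zero_iff)
qed

theorem theorem1p2:
  fixes T :: "'a::{finite,comm_ring_1} fps \<Rightarrow> 'a fps"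
    and q :: nat and b \<alpha> \<beta> :: real and Z :: "nat \<Rightarrow> nat"
  assumes T: "T = collatz"
    and q: "q = CARD('a)"
    and b: "b = 4 * real q - 3"
    and \<alpha>: "\<alpha> = (1 + sqrt b) / 2"
    and \<beta>: "\<beta> = (1 - sqrt b) / 2"
    and Z: "\<And>n. Z n = card (map_cycles T n)"
  shows "{f. eventually_map_periodic T f} =
           {fps_of_poly u * one_plus_X_mult_inverse v | u v. True}
       \<and> (\<forall>n\<ge>1. finite (map_cycles T n) \<and>
            real (Z n) = 1 / real n *
              (\<Sum>d | d dvd n. real_of_int (moebius d) * (\<alpha> ^ (n div d) + \<beta> ^ (n div d))))
       \<and> (\<lambda>n. real (Z n)) \<sim>[at_top] (\<lambda>n. \<alpha> ^ n / real n)"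
proof -
  \<comment> \<open>The ring is nonzero, so 0 and 1 are distinct; this is what makes \<alpha> exceed
    1.\<close>
  have q1: "real q \<ge> 2"
  proof -
    have "card {0, 1 :: 'a} \<le> CARD('a)" by (rule card_mono) simp_all
    then show ?thesis by (simp add: q)
  qed
  have b5: "b \<ge> 5" using q1 by (simp add: b)
  have sqrt_b: "sqrt b * sqrt b = b" "sqrt b > 1" using b5 by simp_all
  have sum: "\<alpha> + \<beta> = 1" by (simp add: \<alpha> \<beta> field_simps)
  \<comment> \<open>The product is \<open>(1 - b) / 4\<close>.\<close>
  have prod: "\<alpha> * \<beta> = 1 - real CARD('a)"
    using sqrt_b(1) b q by (simp add: \<alpha> \<beta> field_simps)
  note fixed = card_fixed_collatz[OF sum prod]
  have finite_cycles: "finite (map_cycles T n)" if "n \<ge> 1" for n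
    unfolding T by (rule finite_map_cycles) (rule fixed(1)[OF that])
  have count: "\<alpha> ^ n + \<beta> ^ n = (\<Sum>d | d dvd n. real d * real (Z d))" if n: "n \<ge> 1" for n
    using card_fixed_eq_sum_map_cycles[OF n fixed(1)[OF n]] fixed(2)[OF n] by (simp add: Z T)
  \<comment> \<open>Inversion is applied to the number \<open>d * Z d\<close> of points of exact
    period \<open>d\<close>.\<close>
  have cycles: "real n * real (Z n) =
      (\<Sum>d | d dvd n. real_of_int (moebius d) * (\<alpha> ^ (n div d) + \<beta> ^ (n div d)))" if "n \<ge> 1" for n
    using moebius_inversion[OF that, of "\<lambda>m. \<alpha> ^ m + \<beta> ^ m" "\<lambda>d. real d * real (Z d)"] count by simp
  have "{f. eventually_map_periodic T f} = {fps_of_poly u * one_plus_X_mult_inverse v | u v. True}"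
    using rational_series_if_eventually_periodic eventually_periodic_if_rational_series
    unfolding T by (auto simp: rational_series_altdef)
  moreover have "real (Z n) = 1 / real n *
      (\<Sum>d | d dvd n. real_of_int (moebius d) * (\<alpha> ^ (n div d) + \<beta> ^ (n div d)))" if "n \<ge> 1" for n
    using that by (simp flip: cycles[OF that])
  moreover have "(\<lambda>n. real (Z n)) \<sim>[at_top] (\<lambda>n. \<alpha> ^ n / real n)"
  proof (rule asymp_equiv_moebius_sum[OF _ _ cycles])
    show "\<alpha> > 1" using sqrt_b(2) by (simp add: \<alpha>)
    \<comment> \<open>A negative \<beta> together with \<alpha> + \<beta> = 1 gives
      \<bar>\<beta>\<bar> = \<alpha> - 1.\<close>
    have "\<beta> < 0" using sqrt_b(2) by (simp add: \<beta>)
    with sum show "\<bar>\<beta>\<bar> < \<alpha>" by simp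
  qed
  ultimately show ?thesis using finite_cycles by blast
qed

end
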